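(* Let $\{\alpha_j\}_{j=0}^\infty$ be a sequence of Verblunsky coefficients with $\sum_{j=0}^\infty |\alpha_j| < \infty$, and let $\{\Phi_n\}$ be the associated monic orthogonal polynomials on the unit circle. Let $\{\beta_j\}_{j=1}^\infty$ be a sequence of points on $\partial\mathbb{D}$. For each $n\ge 1$ let $\{\theta_j^{(n)}\}_{j=1}^n$ be defined so that $0\le \theta_1^{(n)}\le\cdots\le\theta_n^{(n)}<2\pi$ and so that the $e^{i\theta_j^{(n)}}$ are the zeros of the paraorthogonal polynomial $$\Phi_n^{(\beta)}(z) = z\Phi_{n-1}(z)-\bar\beta_n\Phi_{n-1}^*(z).$$ Then, with $\theta_{n+1}^{(n)}\equiv\theta_1^{(n)}+2\pi$, $$\sup_{j=1,\dots,n}\, n\left|\theta_{j+1}^{(n)}-\theta_j^{(n)}-\frac{2\pi}{n}\right|\to 0\quad\text{as } n\to\infty.$$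
   Context: $\mathbb{D}=\{z\in\mathbb{C}: |z|<1\}$. For a probability measure $d\mu$ on $\partial\mathbb{D}$ not supported on a finite set, $\Phi_n$ denotes the monic orthogonal polynomial of degree $n$. For a polynomial $P_n$ of degree at most $n$, $P_n^*(z)=z^n\overline{P_n(1/\bar z)}$. The Verblunsky coefficients are $\alpha_n=-\overline{\Phi_{n+1}(0)}\in\mathbb{D}$; measures $d\mu$ correspond bijectively to sequences $\{\alpha_n\}_{n\ge0}$ in $\mathbb{D}$, and $\Phi_0=1$, $\Phi_{n+1}(z)=z\Phi_n(z)-\bar\alpha_n\Phi_n^*(z)$, $\Phi_{n+1}^*(z)=\Phi_n^*(z)-\alpha_n z\Phi_n(z)$. It is known that all zeros of the paraorthogonal polynomials $\Phi_n^{(\beta)}$ lie on $\partial\mathbb{D}$. *)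

theory Defs
  imports "HOL-Probability.Probability" "HOL-Computational_Algebra.Polynomial"
begin

definition circle_measure :: "complex measure \<Rightarrow> bool" where
  "circle_measure M \<longleftrightarrow>
     prob_space M \<and> sets M = sets (restrict_space borel (sphere (0::complex) 1)) \<and>
     \<not> (\<exists>F. finite F \<and> (AE z in M. z \<in> F))"

definition monic_OPUC :: "complex measure \<Rightarrow> (nat \<Rightarrow> complex poly) \<Rightarrow> bool" where
  "monic_OPUC M \<Phi> \<longleftrightarrow>
     (\<forall>n. degree (\<Phi> n) = n \<and> lead_coeff (\<Phi> n) = 1) \<and>
     (\<forall>m n. m \<noteq> n \<longrightarrow> (LINT z|M. cnj (poly (\<Phi> m) z) * poly (\<Phi> n) z) = 0)"

definition verblunsky :: "(nat \<Rightarrow> complex poly) \<Rightarrow> nat \<Rightarrow> complex" where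
  "verblunsky \<Phi> n = - cnj (poly (\<Phi> (Suc n)) 0)"

text \<open>
  The polynomial \<open>P\<^sup>*\<close>, for \<open>P\<close> regarded as a polynomial of degree at most \<open>n\<close>; the lemma
  gives the usual formula. The index \<open>n\<close> is a parameter, so this is not \<^const>\<open>reflect_poly\<close>,
  which always reverses with respect to the actual degree.
\<close>

definition rev_poly :: "nat \<Rightarrow> complex poly \<Rightarrow> complex poly" where
  "rev_poly n p = (\<Sum>k\<le>n. monom (cnj (coeff p (n - k))) k)"

lemma poly_rev_poly:
  assumes "degree p \<le> n" and "z \<noteq> 0"
  shows "poly (rev_poly n p) z = z ^ n * cnj (poly p (1 / cnj z))"
proof -
  have "poly p w = (\<Sum>i\<le>n. coeff p i * w ^ i)" for w
    unfolding poly_altdef using assms(1)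
    by (intro sum.mono_neutral_left) (auto simp: coeff_eq_0)
  then have "z ^ n * cnj (poly p (1 / cnj z)) = (\<Sum>i\<le>n. cnj (coeff p i) * z ^ (n - i))"
    using assms(2) by (simp add: sum_distrib_left power_diff field_simps)
  also have "\<dots> = (\<Sum>k\<le>n. cnj (coeff p (n - k)) * z ^ k)"
    by (rule sum.reindex_bij_witness[of _ "\<lambda>k. n - k" "\<lambda>k. n - k"]) auto
  also have "\<dots> = poly (rev_poly n p) z"
    by (simp add: rev_poly_def poly_sum poly_monom)
  finally show ?thesis ..
qed

text \<open>Only used for \<open>n \<ge> 1\<close>.\<close>

definition paraorthogonal ::
    "(nat \<Rightarrow> complex poly) \<Rightarrow> (nat \<Rightarrow> complex) \<Rightarrow> nat \<Rightarrow> complex poly" where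
  "paraorthogonal \<Phi> \<beta> n =
     monom 1 1 * \<Phi> (n - 1) - smult (cnj (\<beta> n)) (rev_poly (n - 1) (\<Phi> (n - 1)))"

end

theory Submission
  imports Defs
begin

text \<open>
  On the circle, the recursion \<open>\<Phi>\<^sub>n\<^sub>+\<^sub>1\<^sup>* = \<Phi>\<^sub>n\<^sup>* (1 - \<alpha>\<^sub>n w\<^sub>n)\<close> with \<open>\<bar>w\<^sub>n\<bar> = 1\<close> and \<open>\<bar>\<alpha>\<^sub>n\<bar> < 1\<close>
  gives \<open>\<Phi>\<^sub>n\<^sup>*(e\<^sup>i\<^sup>t)\<close> the continuous periodic argument \<open>S\<^sub>n(t) = \<Sum>\<^sub>k\<^sub><\<^sub>n Arg (1 - \<alpha>\<^sub>k w\<^sub>k)\<close>, and since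
  \<open>\<Sum>\<bar>\<alpha>\<^sub>k\<bar> < \<infinity>\<close> these converge uniformly, so they are equicontinuous. The zeros \<open>e\<^sup>i\<^sup>t\<close> of the
  paraorthogonal polynomial are the solutions of \<open>n t - 2 S\<^sub>n\<^sub>-\<^sub>1(t) = - arg \<beta>\<^sub>n\<close> modulo \<open>2 \<pi>\<close>. The left-hand
  side grows by \<open>2 \<pi> n\<close> over a period and there are only \<open>n\<close> zeros, so it grows by exactly \<open>2 \<pi>\<close>
  between consecutive zeros. Hence \<open>n (\<theta>\<^sub>j\<^sub>+\<^sub>1 - \<theta>\<^sub>j) - 2 \<pi>\<close> is twice an increment of \<open>S\<^sub>n\<^sub>-\<^sub>1\<close>
  over an interval of length \<open>O(1/n)\<close>.
\<close>

section \<open>Integration over the circle and orthogonality\<close>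

lemma circle_measure_space:
  assumes "circle_measure M"
  shows "space M = sphere 0 1"
proof -
  have "sets M = sets (restrict_space borel (sphere (0::complex) 1))"
    using assms by (simp add: circle_measure_def)
  from sets_eq_imp_space_eq[OF this] show ?thesis
    by (simp add: space_restrict_space)
qed

lemma circle_measure_integrable:
  fixes f :: "complex \<Rightarrow> complex"
  assumes M: "circle_measure M" and f: "continuous_on (sphere 0 1) f"
  shows "integrable M f"
proof -
  interpret prob_space M
    using M by (simp add: circle_measure_def)
  have sets: "sets M = sets (restrict_space borel (sphere (0::complex) 1))"
    using M by (simp add: circle_measure_def)
  have meas: "f \<in> borel_measurable M"
    using borel_measurable_continuous_on_restrict[OF f] measurable_cong_sets[OF sets refl]
    by blast
  have "bounded (f ` sphere 0 1)"
    by (intro compact_imp_bounded compact_continuous_image f) simp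
  then obtain B where "\<forall>z\<in>sphere 0 1. norm (f z) \<le> B"
    unfolding bounded_iff by blast
  then show ?thesis
    using meas by (intro integrable_const_bound[of f B]) (auto simp: circle_measure_space[OF M])
qed

lemma continuous_on_poly_id [continuous_intros]:
  "continuous_on S (poly (p :: 'a :: real_normed_field poly))"
  using continuous_on_poly[OF continuous_on_id] by simp

text \<open>The only place where the infinite support of the measure enters.\<close>

lemma circle_measure_positive:
  assumes M: "circle_measure M" and p: "p \<noteq> 0"
  shows "(LINT z|M. norm (poly p z) ^ 2) > 0"
proof -
  interpret prob_space M
    using M by (simp add: circle_measure_def)
  have int: "integrable M (\<lambda>z. norm (poly p z) ^ 2)"
  proof -
    have "integrable M (\<lambda>z. complex_of_real (norm (poly p z) ^ 2))"
      by (intro circle_measure_integrable[OF M] continuous_intros)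
    then show ?thesis
      by (subst (asm) complex_of_real_integrable_eq)
  qed
  have "(LINT z|M. norm (poly p z) ^ 2) \<noteq> 0"
  proof
    assume "(LINT z|M. norm (poly p z) ^ 2) = 0"
    then have "AE z in M. z \<in> {z. poly p z = 0}"
      using integral_nonneg_eq_0_iff_AE[OF int] by simp
    with M poly_roots_finite[OF p] show False
      by (auto simp: circle_measure_def)
  qed
  moreover have "(LINT z|M. norm (poly p z) ^ 2) \<ge> 0"
    by (intro integral_nonneg_AE) simp
  ultimately show ?thesis
    by linarith
qed

lemma circle_measure_integral_norm_eq_0:
  assumes M: "circle_measure M" and "(LINT z|M. cnj (poly p z) * poly p z) = 0"
  shows "p = 0"
proof (rule ccontr)
  have "(LINT z|M. cnj (poly p z) * poly p z) = of_real (LINT z|M. norm (poly p z) ^ 2)"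
    by (subst integral_complex_of_real[symmetric])
      (simp only: complex_norm_square mult.commute)
  moreover assume "p \<noteq> 0"
  ultimately show False
    using circle_measure_positive[OF M, of p] assms(2) by simp
qed

text \<open>Induction on the degree: subtracting the multiple of \<open>\<Phi> m\<close> with the
  same leading term, \<open>m = degree q < n\<close>, lowers the degree and changes the integral by
  0. The disjunct \<open>q = 0\<close> matters for \<open>n = 0\<close>, where no degree lies below
  \<open>n\<close>.\<close>

lemma monic_OPUC_orthogonal_lower_degree:
  assumes M: "circle_measure M" and \<Phi>: "monic_OPUC M \<Phi>"
    and "q = 0 \<or> degree q < n"
  shows "(LINT z|M. cnj (poly q z) * poly (\<Phi> n) z) = 0"
  using assms(3)
proof (induction "degree q" arbitrary: q rule: less_induct)
  case less
  show ?case
  proof (cases "q = 0")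
    case False
    define m where "m = degree q"
    define r where "r = q - smult (lead_coeff q) (\<Phi> m)"
    have deg: "degree (\<Phi> m) = m" and lead: "coeff (\<Phi> m) m = 1"
      and orth: "(LINT z|M. cnj (poly (\<Phi> m) z) * poly (\<Phi> n) z) = 0"
      using \<Phi> False less.prems by (auto simp: monic_OPUC_def m_def) metis
    have "degree r \<le> m"
      unfolding r_def by (intro degree_diff_le) (auto simp: deg m_def[symmetric])
    moreover have "coeff r m = 0"
      by (simp add: r_def lead m_def[symmetric])
    ultimately have "r = 0 \<or> degree r < m"
      using eq_zero_or_degree_less by blast
    then have "(LINT z|M. cnj (poly r z) * poly (\<Phi> n) z) = 0"
      using less.hyps[of r] less.prems False by (auto simp: m_def)
    moreover have "(LINT z|M. cnj (poly q z) * poly (\<Phi> n) z)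
        = (LINT z|M. cnj (poly r z) * poly (\<Phi> n) z
            + cnj (lead_coeff q) * (cnj (poly (\<Phi> m) z) * poly (\<Phi> n) z))"
      by (simp add: r_def algebra_simps)
    moreover have "\<dots> = (LINT z|M. cnj (poly r z) * poly (\<Phi> n) z)
            + cnj (lead_coeff q) * (LINT z|M. cnj (poly (\<Phi> m) z) * poly (\<Phi> n) z)"
      by (subst Bochner_Integration.integral_add)
        (auto intro!: circle_measure_integrable[OF M] continuous_intros)
    ultimately show ?thesis
      by (simp add: orth)
  qed simp
qed

section \<open>Reversed polynomials and the Szego recursion\<close>

lemma unit_mult_cnj:
  assumes "norm z = 1"
  shows "z * cnj z = 1"
  using complex_norm_square[of z] assms by simp

lemma poly_rev_poly_circle:
  assumes "degree p \<le> n" "norm z = 1"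
  shows "poly (rev_poly n p) z = z ^ n * cnj (poly p z)"
proof -
  have "z * cnj z = 1"
    using assms(2) by (rule unit_mult_cnj)
  then have "z \<noteq> 0" "1 / cnj z = z"
    by (auto simp: divide_eq_eq)
  then show ?thesis
    using poly_rev_poly[OF assms(1), of z] by simp
qed

lemma degree_rev_poly_le: "degree (rev_poly n p) \<le> n"
  unfolding rev_poly_def
  by (intro degree_sum_le) (auto intro: order_trans[OF degree_monom_le])

lemma poly_rev_poly_0: "poly (rev_poly n p) 0 = cnj (coeff p n)"
  by (simp add: rev_poly_def poly_sum poly_monom power_0_left if_distrib cong: if_cong)

text \<open>On the circle, reversal is conjugation up to the factor \<open>z ^ n\<close>, which
  cancels in the product. So the integral is the conjugate of the one pairing
  \<open>rev_poly n q\<close> with \<open>\<Phi> n\<close>, and \<open>poly q 0 = 0\<close> pushes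
  the degree of \<open>rev_poly n q\<close> below \<open>n\<close>.\<close>

lemma monic_OPUC_rev_orthogonal:
  assumes M: "circle_measure M" and \<Phi>: "monic_OPUC M \<Phi>"
    and q: "degree q \<le> n" "poly q 0 = 0"
  shows "(LINT z|M. cnj (poly q z) * poly (rev_poly n (\<Phi> n)) z) = 0"
proof -
  have deg: "degree (\<Phi> n) \<le> n"
    using \<Phi> by (simp add: monic_OPUC_def)
  define r where "r = rev_poly n q"
  have "degree r \<le> n"
    unfolding r_def by (rule degree_rev_poly_le)
  moreover have "coeff r n = 0"
    using q(2) unfolding r_def rev_poly_def by (simp add: coeff_sum poly_0_coeff_0)
  ultimately have "r = 0 \<or> degree r < n"
    using eq_zero_or_degree_less by blast
  then have 0: "(LINT z|M. cnj (poly r z) * poly (\<Phi> n) z) = 0"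
    by (rule monic_OPUC_orthogonal_lower_degree[OF M \<Phi>])
  have "(LINT z|M. cnj (poly q z) * poly (rev_poly n (\<Phi> n)) z)
      = (LINT z|M. cnj (cnj (poly r z) * poly (\<Phi> n) z))"
  proof (rule Bochner_Integration.integral_cong[OF refl])
    fix z assume "z \<in> space M"
    then have "norm z = 1"
      by (simp add: circle_measure_space[OF M])
    then show "cnj (poly q z) * poly (rev_poly n (\<Phi> n)) z = cnj (cnj (poly r z) * poly (\<Phi> n) z)"
      by (simp add: r_def poly_rev_poly_circle q(1) deg)
  qed
  also have "\<dots> = cnj (LINT z|M. cnj (poly r z) * poly (\<Phi> n) z)"
    by (rule Bochner_Integration.integral_cnj)
  finally show ?thesis
    by (simp add: 0)
qed

text \<open>The difference \<open>d\<close> of the two sides has degree at most \<open>n\<close>, as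
  the leading terms cancel, and vanishes at 0 by the choice of the Verblunsky coefficient. It is
  therefore orthogonal to each of the three terms composing it, hence to itself.\<close>

theorem Szego_recursion:
  assumes M: "circle_measure M" and \<Phi>: "monic_OPUC M \<Phi>"
  shows "\<Phi> (Suc n) = pCons 0 (\<Phi> n) - smult (cnj (verblunsky \<Phi> n)) (rev_poly n (\<Phi> n))"
proof -
  have deg: "degree (\<Phi> k) = k" and lead: "coeff (\<Phi> k) k = 1" for k
    using \<Phi> by (auto simp: monic_OPUC_def) metis
  define c where "c = cnj (verblunsky \<Phi> n)"
  define d where "d = \<Phi> (Suc n) - pCons 0 (\<Phi> n) + smult c (rev_poly n (\<Phi> n))"
  have "degree d \<le> Suc n"
    unfolding d_def using degree_rev_poly_le[of n "\<Phi> n"]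
    by (intro degree_add_le degree_diff_le) (auto simp: deg degree_pCons_eq_if)
  moreover have "coeff d (Suc n) = 0"
    using degree_rev_poly_le[of n "\<Phi> n"] by (simp add: d_def lead coeff_eq_0)
  ultimately have "d = 0 \<or> degree d < Suc n"
    using eq_zero_or_degree_less by blast
  then have degd: "degree d < Suc n"
    by auto
  have d0: "poly d 0 = 0"
    by (simp add: d_def poly_rev_poly_0 lead c_def verblunsky_def)
  then obtain e where e: "d = pCons 0 e"
    by (metis poly_pCons mult_zero_left add.right_neutral pCons_cases)
  have dege: "e = 0 \<or> degree e < n"
    using degd by (auto simp: e degree_pCons_eq_if split: if_splits)
  have I: "integrable M (\<lambda>z. cnj (poly p z) * poly q z)" for p q
    by (intro circle_measure_integrable[OF M] continuous_intros)
  \<comment> \<open>Both arguments carry a factor z, and these cancel on the circle. What remains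
    pairs \<open>e\<close>, of degree below \<open>n\<close>, with \<open>\<Phi> n\<close>.\<close>
  have "(LINT z|M. cnj (poly d z) * poly (pCons 0 (\<Phi> n)) z)
      = (LINT z|M. cnj (poly e z) * poly (\<Phi> n) z)"
  proof (rule Bochner_Integration.integral_cong[OF refl])
    fix z assume "z \<in> space M"
    then have "z * cnj z = 1"
      by (simp add: circle_measure_space[OF M] unit_mult_cnj)
    then show "cnj (poly d z) * poly (pCons 0 (\<Phi> n)) z = cnj (poly e z) * poly (\<Phi> n) z"
      by (simp add: e algebra_simps)
  qed
  also have "\<dots> = 0"
    using dege by (rule monic_OPUC_orthogonal_lower_degree[OF M \<Phi>])
  finally have 1: "(LINT z|M. cnj (poly d z) * poly (pCons 0 (\<Phi> n)) z) = 0" .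
  have 2: "(LINT z|M. cnj (poly d z) * poly (\<Phi> (Suc n)) z) = 0"
    using degd by (intro monic_OPUC_orthogonal_lower_degree[OF M \<Phi>]) auto
  have 3: "(LINT z|M. cnj (poly d z) * poly (rev_poly n (\<Phi> n)) z) = 0"
    using degd d0 by (intro monic_OPUC_rev_orthogonal[OF M \<Phi>]) auto
  have "(LINT z|M. cnj (poly d z) * poly d z)
      = (LINT z|M. cnj (poly d z) * poly (\<Phi> (Suc n)) z - cnj (poly d z) * poly (pCons 0 (\<Phi> n)) z
          + c * (cnj (poly d z) * poly (rev_poly n (\<Phi> n)) z))"
    by (rule Bochner_Integration.integral_cong[OF refl], subst (2) d_def) (simp add: algebra_simps)
  also have "\<dots> = 0"
    using 1 2 3
    by (simp only: Bochner_Integration.integral_add Bochner_Integration.integral_diff I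
        Bochner_Integration.integrable_diff integrable_mult_right integral_mult_right_zero) simp
  finally have "d = 0"
    by (rule circle_measure_integral_norm_eq_0[OF M])
  then show ?thesis
    by (simp add: d_def c_def algebra_simps)
qed

lemma norm_rev_poly_circle:
  assumes "degree p \<le> n" "norm z = 1"
  shows "norm (poly (rev_poly n p) z) = norm (poly p z)"
  using assms by (simp add: poly_rev_poly_circle norm_mult norm_power)

text \<open>Pythagoras: by the recursion, z times \<open>\<Phi> n\<close> is the orthogonal sum of
  \<open>\<Phi> (Suc n)\<close> and \<open>cnj a\<close> times \<open>R\<close>. On the circle z
  times \<open>\<Phi> n\<close> and \<open>R\<close> both have the modulus of
  \<open>\<Phi> n\<close>, so \<open>N (\<Phi> (Suc n))\<close> is \<open>1 - norm a ^ 2\<close>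
  times \<open>N (\<Phi> n)\<close>, and both are positive.\<close>

theorem norm_verblunsky_less_1:
  assumes M: "circle_measure M" and \<Phi>: "monic_OPUC M \<Phi>"
  shows "norm (verblunsky \<Phi> n) < 1"
proof -
  have deg: "degree (\<Phi> k) = k" and nz: "\<Phi> k \<noteq> 0" for k
    using \<Phi> by (auto simp: monic_OPUC_def) (metis coeff_0 zero_neq_one)
  define a where "a = verblunsky \<Phi> n"
  define R where "R = rev_poly n (\<Phi> n)"
  define N where "N p = (LINT z|M. norm (poly p z) ^ 2)" for p :: "complex poly"
  have I: "integrable M (\<lambda>z. cnj (poly p z) * poly q z)" for p q
    by (intro circle_measure_integrable[OF M] continuous_intros)
  have N: "of_real (N p) = (LINT z|M. cnj (poly p z) * poly p z)" for p
    unfolding N_def by (subst integral_complex_of_real[symmetric])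
      (simp only: complex_norm_square mult.commute)
  have rec: "pCons 0 (\<Phi> n) = \<Phi> (Suc n) + smult (cnj a) R"
    using Szego_recursion[OF M \<Phi>, of n] by (simp add: a_def R_def)
  have degR: "R = 0 \<or> degree R < Suc n"
    using degree_rev_poly_le[of n "\<Phi> n"] by (simp add: R_def)
  have o1: "(LINT z|M. cnj (poly R z) * poly (\<Phi> (Suc n)) z) = 0"
    using degR by (rule monic_OPUC_orthogonal_lower_degree[OF M \<Phi>])
  have "(LINT z|M. cnj (poly (\<Phi> (Suc n)) z) * poly R z)
      = (LINT z|M. cnj (cnj (poly R z) * poly (\<Phi> (Suc n)) z))"
    by (simp add: mult.commute)
  also have "\<dots> = 0"
    using o1 by (subst Bochner_Integration.integral_cnj) simp
  finally have o2: "(LINT z|M. cnj (poly (\<Phi> (Suc n)) z) * poly R z) = 0" .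
  have "complex_of_real (N (pCons 0 (\<Phi> n)))
      = (LINT z|M. cnj (poly (\<Phi> (Suc n)) z) * poly (\<Phi> (Suc n)) z
          + cnj a * (cnj (poly (\<Phi> (Suc n)) z) * poly R z)
          + a * (cnj (poly R z) * poly (\<Phi> (Suc n)) z)
          + a * cnj a * (cnj (poly R z) * poly R z))"
    unfolding N rec by (simp add: algebra_simps)
  also have "\<dots> = of_real (N (\<Phi> (Suc n))) + a * cnj a * of_real (N R)"
    by (simp only: Bochner_Integration.integral_add I Bochner_Integration.integrable_add
        integrable_mult_right integral_mult_right_zero o1 o2 N) simp
  also have "\<dots> = of_real (N (\<Phi> (Suc n)) + norm a ^ 2 * N R)"
    by (simp only: of_real_add of_real_mult complex_norm_square)
  finally have "N (pCons 0 (\<Phi> n)) = N (\<Phi> (Suc n)) + norm a ^ 2 * N R"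
    by (simp only: of_real_eq_iff)
  moreover have "N (pCons 0 (\<Phi> n)) = N (\<Phi> n)" "N R = N (\<Phi> n)"
    unfolding N_def R_def
    by (auto intro!: Bochner_Integration.integral_cong
        simp: circle_measure_space[OF M] norm_mult norm_rev_poly_circle deg)
  ultimately have "N (\<Phi> n) * (1 - norm a ^ 2) = N (\<Phi> (Suc n))"
    by (simp add: algebra_simps)
  moreover have "N (\<Phi> k) > 0" for k
    unfolding N_def using circle_measure_positive[OF M nz] .
  ultimately have "1 - norm a ^ 2 > 0"
    using zero_less_mult_pos by metis
  then show ?thesis
    by (simp add: a_def[symmetric] abs_square_less_1)
qed

section \<open>Level crossings and the enumeration of zeros\<close>

text \<open>The intermediate value theorem is applied repeatedly, each time between the previous
  crossing and \<open>b\<close>, so the crossings come out sorted. The separate bound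
  \<open>m\<close> lets the induction run with \<open>b\<close> and \<open>n\<close> fixed.\<close>

lemma level_crossings:
  fixes \<eta> :: "real \<Rightarrow> real"
  assumes cont: "continuous_on UNIV \<eta>" and h: "h > 0" and ab: "a \<le> b"
    and fin: "\<eta> b = \<eta> a + h * real n" and "m \<le> n"
  shows "\<exists>x. x 0 = a \<and> (\<forall>k<m. x k \<le> x (Suc k)) \<and>
           (\<forall>k\<le>m. \<eta> (x k) = \<eta> a + h * real k \<and> a \<le> x k \<and> x k \<le> b)"
  using \<open>m \<le> n\<close>
proof (induction m)
  case 0
  show ?case
    using ab by (intro exI[of _ "\<lambda>_. a"]) auto
next
  case (Suc m)
  then obtain x where x: "x 0 = a" "\<forall>k<m. x k \<le> x (Suc k)"
    "\<forall>k\<le>m. \<eta> (x k) = \<eta> a + h * real k \<and> a \<le> x k \<and> x k \<le> b"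
    by auto
  have "h * real (Suc m) \<le> h * real n"
    using Suc.prems h by (intro mult_left_mono) auto
  then have "\<exists>y. x m \<le> y \<and> y \<le> b \<and> \<eta> y = \<eta> a + h * real (Suc m)"
    using x(3) h fin continuous_on_subset[OF cont]
    by (intro IVT') (auto simp: algebra_simps)
  then obtain y where "x m \<le> y" "y \<le> b" "\<eta> y = \<eta> a + h * real (Suc m)"
    by blast
  moreover from this have "a \<le> y"
    using x(3) order_trans by blast
  ultimately show ?case
    using x by (intro exI[of _ "x(Suc m := y)"]) (simp add: le_Suc_eq less_Suc_eq all_conj_distrib)
qed

text \<open>The \<open>n\<close> distinct values of \<open>x\<close> lie among at most
  \<open>n\<close> values of \<open>y\<close>. So the two images agree, \<open>y\<close> is
  injective too, and a finite set has only one increasing enumeration.\<close>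

lemma sorted_enumeration_unique:
  fixes x y :: "nat \<Rightarrow> 'a :: linorder"
  assumes x: "\<And>i j. i \<le> j \<Longrightarrow> j < n \<Longrightarrow> x i \<le> x j" "inj_on x {..<n}"
    and y: "\<And>i j. i \<le> j \<Longrightarrow> j < n \<Longrightarrow> y i \<le> y j"
    and sub: "x ` {..<n} \<subseteq> y ` {..<n}" and "k < n"
  shows "x k = y k"
proof -
  have "card (y ` {..<n}) \<le> n"
    using card_image_le[of "{..<n}" y] by simp
  moreover have "card (x ` {..<n}) = n"
    using card_image[OF x(2)] by simp
  ultimately have eq: "x ` {..<n} = y ` {..<n}" and card: "card (y ` {..<n}) = n"
    using sub card_mono[OF _ sub] card_subset_eq[OF _ sub] by auto
  have "inj_on y {..<n}"
    by (rule eq_card_imp_inj_on) (simp_all add: card)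
  then have "map x [0..<n] = map y [0..<n]"
    using x y eq
    by (intro sorted_distinct_set_unique)
      (auto simp: sorted_iff_nth_mono distinct_map atLeast0LessThan)
  then show ?thesis
    using \<open>k < n\<close> by (simp add: list_eq_iff_nth_eq)
qed

text \<open>The levels \<open>\<eta> (t 1) + 2 \<pi> k\<close>, crossed in this order, already account for \<open>n\<close> different
  solutions, hence for all of them. So no monotonicity of the phase \<open>\<eta>\<close> is needed.\<close>

lemma phase_increment:
  fixes \<eta> t :: "_ \<Rightarrow> real"
  assumes cont: "continuous_on UNIV \<eta>" and n: "n \<ge> 1"
    and per: "\<And>x. \<eta> (x + 2 * pi) = \<eta> x + 2 * pi * real n"
    and mono: "\<And>i j. 1 \<le> i \<Longrightarrow> i \<le> j \<Longrightarrow> j \<le> n \<Longrightarrow> t i \<le> t j"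
    and range: "\<And>j. 1 \<le> j \<Longrightarrow> j \<le> n \<Longrightarrow> 0 \<le> t j \<and> t j < 2 * pi"
    and wrap: "t (n + 1) = t 1 + 2 * pi"
    and sol: "cis (\<eta> (t 1)) = c"
    and complete: "\<And>x. cis (\<eta> x) = c \<Longrightarrow> \<exists>j\<in>{1..n}. cis x = cis (t j)"
    and j: "j \<in> {1..n}"
  shows "\<eta> (t (j + 1)) - \<eta> (t j) = 2 * pi"
proof -
  obtain x where x0: "x 0 = t 1" and xS: "\<forall>k<n. x k \<le> x (Suc k)"
    and xk: "\<And>k. k \<le> n \<Longrightarrow> \<eta> (x k) = \<eta> (t 1) + 2 * pi * real k \<and> t 1 \<le> x k \<and> x k \<le> t 1 + 2 * pi"
    using level_crossings[OF cont, of "2 * pi" "t 1" "t 1 + 2 * pi" n n] per by auto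
  have inj: "inj_on x {..<n}"
  proof (rule inj_onI)
    fix k l assume kl: "k \<in> {..<n}" "l \<in> {..<n}" "x k = x l"
    then have "2 * pi * real k = 2 * pi * real l"
      using xk[of k] xk[of l] by (metis add_left_cancel lessThan_iff less_imp_le)
    then show "k = l"
      by simp
  qed
  have xmono: "x k \<le> x l" if "k \<le> l" "l < n" for k l
    using that
  proof (induction l)
    case (Suc l)
    have "x l \<le> x (Suc l)"
      using xS Suc.prems by simp
    then show ?case
      using Suc.IH Suc.prems by (cases "k = Suc l") auto
  qed simp
  have "x ` {..<n} \<subseteq> (\<lambda>k. t (Suc k)) ` {..<n}"
  proof clarify
    fix k assume k: "k < n"
    \<comment> \<open>The right endpoint carries level \<open>n\<close>, so the crossings with
      \<open>k < n\<close> stay in the half-open period starting at \<open>t 1\<close>.\<close>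
    have "x k \<noteq> t 1 + 2 * pi"
    proof
      assume "x k = t 1 + 2 * pi"
      then have "2 * pi * real k = 2 * pi * real n"
        using xk[of k] per[of "t 1"] k by simp
      then show False
        using k by simp
    qed
    then have lt: "x k < t 1 + 2 * pi" "t 1 \<le> x k"
      using xk[of k] k by auto
    have "cis (\<eta> (x k)) = cis (\<eta> (t 1) + 2 * pi * real k)"
      using xk[of k] k by simp
    also have "\<dots> = cis (\<eta> (t 1)) * cis (2 * pi * real k)"
      by (simp only: cis_mult)
    also have "cis (2 * pi * real k) = 1"
      by (rule cis_multiple_2pi) simp
    finally obtain i where i: "i \<in> {1..n}" "cis (x k) = cis (t i)"
      using complete[of "x k"] sol by auto
    then obtain m :: int where "\<i> * of_real (x k) = \<i> * of_real (t i) + of_real (of_int (2 * m) * pi) * \<i>"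
      by (auto simp: cis_conv_exp exp_eq)
    from arg_cong[OF this, of Im] have m: "x k = t i + 2 * pi * of_int m"
      by simp
    \<comment> \<open>Since \<open>t 1 \<le> t i\<close>, a positive \<open>m\<close> would put
      \<open>x k\<close> at or beyond \<open>t 1 + 2 * pi\<close>; since
      \<open>t i < 2 * pi\<close>, a negative one would put it below 0.\<close>
    have "t 1 \<le> t i" "t i < 2 * pi" "0 \<le> t 1"
      using mono[of 1 i] range[of i] range[of 1] i n by auto
    then have "2 * pi * real_of_int m < 2 * pi * 1" "2 * pi * (-1) < 2 * pi * real_of_int m"
      using lt m by linarith+
    then have "real_of_int m < 1" "-1 < real_of_int m"
      by (simp_all only: mult_less_cancel_left_pos[of "2 * pi"] pi_gt_zero zero_less_mult_iff
          zero_less_numeral simp_thms)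
    then have "m = 0"
      by linarith
    then show "x k \<in> (\<lambda>k. t (Suc k)) ` {..<n}"
      using m i by (intro image_eqI[of _ _ "i - 1"]) auto
  qed
  then have eq: "x k = t (Suc k)" if "k < n" for k
    using sorted_enumeration_unique[of n x "\<lambda>k. t (Suc k)" k] xmono inj mono that by auto
  \<comment> \<open>The case \<open>k = n\<close> concerns the wrapped point
    \<open>t (n + 1)\<close>, where \<open>per\<close> gives the value.\<close>
  have "\<eta> (t (Suc k)) = \<eta> (t 1) + 2 * pi * real k" if "k \<le> n" for k
    using eq[of k] xk[of k] per[of "t 1"] wrap that by (cases "k = n") auto
  from this[of j] this[of "j - 1"] show ?thesis
    using j by (auto simp: of_nat_diff algebra_simps)
qed

section \<open>Equicontinuity and bounds for the logarithm\<close>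

text \<open>The limit is uniformly continuous by compactness; passing from \<open>f n\<close> to
  \<open>l\<close> and back costs a third of \<epsilon> each time.\<close>

lemma uniform_limit_equicontinuous:
  fixes f :: "nat \<Rightarrow> 'a :: metric_space \<Rightarrow> 'b :: metric_space"
  assumes K: "compact K" and cont: "\<And>n. continuous_on K (f n)"
    and lim: "uniform_limit K f l sequentially" and \<epsilon>: "\<epsilon> > 0"
  obtains \<delta> N where "\<delta> > 0"
    "\<And>n x y. n \<ge> N \<Longrightarrow> x \<in> K \<Longrightarrow> y \<in> K \<Longrightarrow> dist x y < \<delta> \<Longrightarrow> dist (f n x) (f n y) < \<epsilon>"
proof -
  have "continuous_on K l"
    by (rule uniform_limit_theorem[OF _ lim]) (auto simp: cont)
  then have "uniformly_continuous_on K l"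
    using K by (rule compact_uniformly_continuous)
  then obtain \<delta> where \<delta>: "\<delta> > 0"
    "\<And>x y. x \<in> K \<Longrightarrow> y \<in> K \<Longrightarrow> dist x y < \<delta> \<Longrightarrow> dist (l x) (l y) < \<epsilon> / 3"
    unfolding uniformly_continuous_on_def using \<epsilon>
    by (metis dist_commute divide_pos_pos zero_less_numeral)
  have "\<forall>\<^sub>F n in sequentially. \<forall>x\<in>K. dist (f n x) (l x) < \<epsilon> / 3"
    using \<epsilon> by (intro uniform_limitD[OF lim]) simp
  then obtain N where N: "\<And>n x. n \<ge> N \<Longrightarrow> x \<in> K \<Longrightarrow> dist (f n x) (l x) < \<epsilon> / 3"
    by (auto simp: eventually_sequentially)
  show ?thesis
  proof (rule that[OF \<delta>(1)])
    fix n x y assume *: "n \<ge> N" "x \<in> K" "y \<in> K" "dist x y < \<delta>"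
    have "dist (f n x) (f n y) \<le> dist (f n x) (l x) + dist (l x) (l y) + dist (f n y) (l y)"
      by (metis dist_triangle dist_triangle2 order_trans add_left_mono add.assoc)
    also have "\<dots> < \<epsilon>"
      using N[OF *(1,2)] N[OF *(1,3)] \<delta>(2)[OF *(2-4)] by linarith
    finally show "dist (f n x) (f n y) < \<epsilon>" .
  qed
qed

text \<open>A linear bound on the whole open disk, as the M-test requires. For small
  \<open>w\<close> it comes from the bound on the logarithm near 1; otherwise an argument is at most
  \<open>pi\<close>, and \<open>norm w\<close> is at least 1/2.\<close>

lemma abs_Im_Ln_one_minus_le:
  assumes w: "norm w < 1"
  shows "\<bar>Im (Ln (1 - w))\<bar> \<le> 2 * pi * norm w"
proof (cases "norm w < 1 / 2")
  case True
  have "\<bar>Im (Ln (1 - w))\<bar> \<le> 2 * norm w"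
    using norm_Ln_le[of "- w"] True abs_Im_le_cmod[of "Ln (1 - w)"] by simp
  also have "\<dots> \<le> 2 * pi * norm w"
    using pi_gt3 by (intro mult_right_mono) auto
  finally show ?thesis .
next
  case False
  have "1 - w \<noteq> 0"
    using w by auto
  then have "\<bar>Im (Ln (1 - w))\<bar> \<le> pi"
    using mpi_less_Im_Ln[of "1 - w"] Im_Ln_le_pi[of "1 - w"] by linarith
  also have "pi * 1 \<le> pi * (2 * norm w)"
    using False by (intro mult_left_mono) auto
  finally show ?thesis
    by (simp add: mult_ac)
qed

lemma polar_Ln:
  assumes "z \<noteq> 0"
  shows "z = of_real (norm z) * cis (Im (Ln z))"
  using exp_eq_polar[of "Ln z"] assms by (simp add: Re_Ln flip: norm_exp_eq_Re)

section \<open>The phase of the reversed polynomials\<close>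

text \<open>This is \<open>w\<^sub>n\<close> of the overview: dividing the recursion for the
  reversed polynomials by the \<open>n\<close>-th one leaves one minus the Verblunsky coefficient
  times this ratio.\<close>

definition szego_ratio :: "(nat \<Rightarrow> complex poly) \<Rightarrow> nat \<Rightarrow> complex \<Rightarrow> complex" where
  "szego_ratio \<Phi> n z = z * poly (\<Phi> n) z / poly (rev_poly n (\<Phi> n)) z"

text \<open>A continuous argument of \<open>\<Phi>\<^sub>n\<^sup>*\<close> on the circle. It is \<open>2 \<pi>\<close>-periodic by construction,
  which encodes that \<open>\<Phi>\<^sub>n\<^sup>*\<close> has winding number zero around the origin.\<close>

definition szego_phase :: "(nat \<Rightarrow> complex poly) \<Rightarrow> nat \<Rightarrow> real \<Rightarrow> real" where
  "szego_phase \<Phi> n t = (\<Sum>k<n. Im (Ln (1 - verblunsky \<Phi> k * szego_ratio \<Phi> k (cis t))))"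

lemma szego_phase_periodic: "szego_phase \<Phi> n (t + 2 * pi) = szego_phase \<Phi> n t"
  by (simp add: szego_phase_def flip: cis_mult)

context
  fixes M \<Phi>
  assumes M: "circle_measure M" and \<Phi>: "monic_OPUC M \<Phi>"
begin

lemma monic_OPUC_degree: "degree (\<Phi> n) = n"
  using \<Phi> by (simp add: monic_OPUC_def)

lemma rev_poly_Suc_circle:
  assumes z: "norm z = 1"
  shows "poly (rev_poly (Suc n) (\<Phi> (Suc n))) z
    = poly (rev_poly n (\<Phi> n)) z - verblunsky \<Phi> n * (z * poly (\<Phi> n) z)"
proof -
  have zn: "z ^ n * cnj z ^ n = 1"
    using unit_mult_cnj[OF z] by (simp flip: power_mult_distrib)
  have "poly (\<Phi> (Suc n)) z
      = z * poly (\<Phi> n) z - cnj (verblunsky \<Phi> n) * (z ^ n * cnj (poly (\<Phi> n) z))"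
    using z by (subst Szego_recursion[OF M \<Phi>]) (simp add: poly_rev_poly_circle monic_OPUC_degree)
  then have "poly (rev_poly (Suc n) (\<Phi> (Suc n))) z
      = z ^ Suc n * cnj (z * poly (\<Phi> n) z - cnj (verblunsky \<Phi> n) * (z ^ n * cnj (poly (\<Phi> n) z)))"
    using z by (simp only: poly_rev_poly_circle monic_OPUC_degree order_refl)
  also have "\<dots> = (z * cnj z) * (z ^ n * cnj (poly (\<Phi> n) z))
      - verblunsky \<Phi> n * (z * poly (\<Phi> n) z) * (z ^ n * cnj z ^ n)"
    by (simp add: algebra_simps)
  finally show ?thesis
    using z by (simp add: zn unit_mult_cnj poly_rev_poly_circle monic_OPUC_degree)
qed

text \<open>On the circle a polynomial and its reversal have equal modulus, so in the recursion the
  subtracted term is strictly smaller than the term it is subtracted from.\<close>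

lemma rev_poly_nonzero_circle:
  assumes z: "norm z = 1"
  shows "poly (rev_poly n (\<Phi> n)) z \<noteq> 0"
proof (induction n)
  case 0
  have "coeff (\<Phi> 0) 0 = 1"
    using \<Phi> by (auto simp: monic_OPUC_def) metis
  then show ?case
    by (simp add: rev_poly_def)
next
  case (Suc n)
  have "norm (verblunsky \<Phi> n * (z * poly (\<Phi> n) z))
      = norm (verblunsky \<Phi> n) * norm (poly (rev_poly n (\<Phi> n)) z)"
    using z by (simp add: norm_mult norm_rev_poly_circle monic_OPUC_degree)
  also have "\<dots> < norm (poly (rev_poly n (\<Phi> n)) z)"
    using norm_verblunsky_less_1[OF M \<Phi>, of n] Suc by simp
  finally show ?case
    using z by (auto simp: rev_poly_Suc_circle)
qed

lemma norm_szego_ratio: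
  assumes z: "norm z = 1"
  shows "norm (szego_ratio \<Phi> n z) = 1"
proof -
  have "norm (poly (rev_poly n (\<Phi> n)) z) = norm (poly (\<Phi> n) z)"
    using z by (simp add: norm_rev_poly_circle monic_OPUC_degree)
  moreover from this have "poly (\<Phi> n) z \<noteq> 0"
    using rev_poly_nonzero_circle[OF z, of n] by auto
  ultimately show ?thesis
    using z by (simp add: szego_ratio_def norm_divide norm_mult)
qed

lemma norm_verblunsky_szego_ratio:
  "norm (verblunsky \<Phi> k * szego_ratio \<Phi> k (cis t)) = norm (verblunsky \<Phi> k)"
  by (simp add: norm_mult norm_szego_ratio)

text \<open>Each recursion step multiplies by a nonzero factor \<open>u\<close>, whose principal
  argument is exactly the next summand of \<open>szego_phase\<close>.\<close>

lemma rev_poly_polar: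
  "poly (rev_poly n (\<Phi> n)) (cis t)
    = of_real (norm (poly (rev_poly n (\<Phi> n)) (cis t))) * cis (szego_phase \<Phi> n t)"
proof (induction n)
  case 0
  have "coeff (\<Phi> 0) 0 = 1"
    using \<Phi> by (auto simp: monic_OPUC_def) metis
  then show ?case
    by (simp add: rev_poly_def szego_phase_def)
next
  case (Suc n)
  define u where "u = 1 - verblunsky \<Phi> n * szego_ratio \<Phi> n (cis t)"
  define R where "R = poly (rev_poly n (\<Phi> n)) (cis t)"
  have "u \<noteq> 0"
    using norm_verblunsky_szego_ratio[of n t] norm_verblunsky_less_1[OF M \<Phi>, of n]
    by (auto simp: u_def)
  then have u: "u = of_real (norm u) * cis (Im (Ln u))"
    by (rule polar_Ln)
  have R: "R = of_real (norm R) * cis (szego_phase \<Phi> n t)"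
    using Suc by (simp add: R_def)
  have step: "poly (rev_poly (Suc n) (\<Phi> (Suc n))) (cis t) = R * u"
    using rev_poly_nonzero_circle[of "cis t" n]
    by (simp add: rev_poly_Suc_circle R_def u_def szego_ratio_def field_simps)
  have "R * u = of_real (norm R * norm u) * (cis (szego_phase \<Phi> n t) * cis (Im (Ln u)))"
    by (subst R, subst u) (simp add: mult_ac)
  also have "\<dots> = of_real (norm (R * u)) * cis (szego_phase \<Phi> (Suc n) t)"
    by (simp add: szego_phase_def u_def cis_mult norm_mult)
  finally show ?case
    unfolding step .
qed

text \<open>Each \<open>1 - verblunsky \<Phi> k * szego_ratio \<Phi> k (cis t)\<close> has positive
  real part, so it avoids the branch cut of \<open>Ln\<close>.\<close>

lemma continuous_on_szego_phase: "continuous_on S (szego_phase \<Phi> n)"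
proof -
  have "1 - verblunsky \<Phi> k * szego_ratio \<Phi> k (cis t) \<notin> \<real>\<^sub>\<le>\<^sub>0" for k t
    using complex_Re_le_cmod[of "verblunsky \<Phi> k * szego_ratio \<Phi> k (cis t)"]
      norm_verblunsky_less_1[OF M \<Phi>, of k]
    by (simp add: complex_nonpos_Reals_iff norm_verblunsky_szego_ratio del: times_complex.sel)
  moreover have "continuous_on S (\<lambda>t. szego_ratio \<Phi> k (cis t))" for k
    unfolding szego_ratio_def
    by (intro continuous_on_divide continuous_on_mult continuous_on_poly continuous_on_cis
        continuous_on_id) (simp add: rev_poly_nonzero_circle)
  ultimately show ?thesis
    unfolding szego_phase_def
    by (intro continuous_on_sum continuous_on_Im continuous_on_Ln' continuous_on_diff
        continuous_on_mult continuous_on_const) auto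
qed

lemma abs_szego_phase_summand_le:
  "\<bar>Im (Ln (1 - verblunsky \<Phi> k * szego_ratio \<Phi> k (cis t)))\<bar> \<le> 2 * pi * norm (verblunsky \<Phi> k)"
  using abs_Im_Ln_one_minus_le[of "verblunsky \<Phi> k * szego_ratio \<Phi> k (cis t)"]
    norm_verblunsky_less_1[OF M \<Phi>, of k]
  by (simp add: norm_verblunsky_szego_ratio)

text \<open>Uniformity in \<open>n\<close> and \<open>t\<close> is the point: it yields the a priori
  O(1/n) bound on the gaps between zeros.\<close>

lemma abs_szego_phase_le:
  assumes "summable (\<lambda>j. norm (verblunsky \<Phi> j))"
  shows "\<bar>szego_phase \<Phi> n t\<bar> \<le> 2 * pi * (\<Sum>j. norm (verblunsky \<Phi> j))"
proof -
  have "\<bar>szego_phase \<Phi> n t\<bar> \<le> (\<Sum>k<n. 2 * pi * norm (verblunsky \<Phi> k))"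
    unfolding szego_phase_def
    by (rule order_trans[OF sum_abs]) (intro sum_mono abs_szego_phase_summand_le)
  also have "\<dots> = 2 * pi * (\<Sum>k<n. norm (verblunsky \<Phi> k))"
    by (simp add: sum_distrib_left)
  also have "\<dots> \<le> 2 * pi * (\<Sum>j. norm (verblunsky \<Phi> j))"
    using assms by (intro mult_left_mono sum_le_suminf) auto
  finally show ?thesis .
qed

lemma szego_phase_uniform_limit:
  assumes "summable (\<lambda>j. norm (verblunsky \<Phi> j))"
  shows "\<exists>l. uniform_limit UNIV (szego_phase \<Phi>) l sequentially"
proof -
  have "uniform_limit UNIV (\<lambda>n t. \<Sum>k<n. Im (Ln (1 - verblunsky \<Phi> k * szego_ratio \<Phi> k (cis t))))
      (\<lambda>t. \<Sum>k. Im (Ln (1 - verblunsky \<Phi> k * szego_ratio \<Phi> k (cis t)))) sequentially"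
    using assms abs_szego_phase_summand_le
    by (intro Weierstrass_m_test[where M = "\<lambda>k. 2 * pi * norm (verblunsky \<Phi> k)"])
      (auto intro: summable_mult)
  then show ?thesis
    by (auto simp: szego_phase_def[abs_def])
qed

text \<open>With \<open>R = r * cis S\<close> the reversed polynomial at \<open>cis t\<close>, the
  other term is \<open>cis t ^ n * cnj R\<close>, that is \<open>r * cis (n * t - S)\<close>.
  Factoring out the nonzero \<open>r * cis S\<close> leaves the stated equation.\<close>

lemma paraorthogonal_zero_iff:
  assumes n: "n \<ge> 1"
  shows "poly (paraorthogonal \<Phi> \<beta> n) (cis t) = 0
    \<longleftrightarrow> cis (real n * t - 2 * szego_phase \<Phi> (n - 1) t) = cnj (\<beta> n)"
proof -
  obtain m where m: "n = Suc m"
    using n by (cases n) auto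
  define S where "S = szego_phase \<Phi> m t"
  define R where "R = poly (rev_poly m (\<Phi> m)) (cis t)"
  define r where "r = norm R"
  have R: "R = of_real r * cis S"
    using rev_poly_polar[of m t] by (simp add: R_def r_def S_def)
  have r: "r \<noteq> 0"
    by (simp add: r_def R_def rev_poly_nonzero_circle)
  have "cis t ^ m * cnj R = poly (\<Phi> m) (cis t) * (cis t ^ m * cnj (cis t) ^ m)"
    by (simp add: R_def poly_rev_poly_circle monic_OPUC_degree)
  also have "\<dots> = poly (\<Phi> m) (cis t)"
    by (simp add: unit_mult_cnj del: cis_cnj flip: power_mult_distrib)
  finally have P: "poly (\<Phi> m) (cis t) = cis t ^ m * cnj R" ..
  have "cis t * poly (\<Phi> m) (cis t) = of_real r * cis (real n * t - 2 * S) * cis S"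
  proof -
    have "cis t * (cis t ^ m * cis (- S)) = cis (real n * t - 2 * S) * cis S"
      unfolding Complex.DeMoivre cis_mult by (simp add: m algebra_simps)
    then show ?thesis
      by (simp add: P R cis_cnj mult_ac)
  qed
  then have "poly (paraorthogonal \<Phi> \<beta> n) (cis t)
      = of_real r * cis S * (cis (real n * t - 2 * S) - cnj (\<beta> n))"
    by (simp add: paraorthogonal_def m poly_monom R_def[symmetric] R algebra_simps)
  then show ?thesis
    using r by (simp add: m S_def)
qed

end

section \<open>Spacing of consecutive zeros\<close>

theorem theorem4p1:
  fixes M :: "complex measure"
    and \<Phi> :: "nat \<Rightarrow> complex poly"
    and \<alpha> \<beta> :: "nat \<Rightarrow> complex"
    and \<theta> :: "nat \<Rightarrow> nat \<Rightarrow> real"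
  assumes "circle_measure M"
    and "monic_OPUC M \<Phi>"
    and "\<And>j. \<alpha> j = verblunsky \<Phi> j"
    and "summable (\<lambda>j. norm (\<alpha> j))"
    and "\<And>j. j \<ge> 1 \<Longrightarrow> \<beta> j \<in> sphere 0 1"
    and "\<And>n j. 1 \<le> j \<Longrightarrow> j \<le> n \<Longrightarrow> 0 \<le> \<theta> n j \<and> \<theta> n j < 2 * pi"
    and "\<And>n i j. 1 \<le> i \<Longrightarrow> i \<le> j \<Longrightarrow> j \<le> n \<Longrightarrow> \<theta> n i \<le> \<theta> n j"
    and "\<And>n. n \<ge> 1 \<Longrightarrow>
           image_mset (\<lambda>j. exp (\<i> * of_real (\<theta> n j))) (mset_set {1..n})
             = proots (paraorthogonal \<Phi> \<beta> n)"
    and "\<And>n. n \<ge> 1 \<Longrightarrow> \<theta> n (n + 1) = \<theta> n 1 + 2 * pi"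
  shows "(\<lambda>n. SUP j\<in>{1..n}. real n * \<bar>\<theta> n (j + 1) - \<theta> n j - 2 * pi / real n\<bar>)
           \<longlonglongrightarrow> 0"
proof -
  note M = assms(1) and \<Phi> = assms(2) and mono = assms(7)
  have summ: "summable (\<lambda>j. norm (verblunsky \<Phi> j))"
    using assms(3,4) by simp
  define S where "S = szego_phase \<Phi>"
  define B where "B = 2 * pi * (\<Sum>j. norm (verblunsky \<Phi> j))"
  have B: "\<bar>S n t\<bar> \<le> B" for n t
    unfolding S_def B_def by (rule abs_szego_phase_le[OF M \<Phi> summ])
  have S_diff: "2 * (S n x - S n y) \<le> 4 * B" for n x y
  proof -
    have "S n x - S n y \<le> B - (- B)"
      using B[of n x] B[of n y] by (intro diff_mono) (auto simp: abs_le_iff)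
    then show ?thesis
      by simp
  qed
  have incr: "real n * (\<theta> n (j + 1) - \<theta> n j) - 2 * pi
      = 2 * (S (n - 1) (\<theta> n (j + 1)) - S (n - 1) (\<theta> n j))" if j: "j \<in> {1..n}" for n j
  proof -
    have n: "n \<ge> 1"
      using j by simp
    define P where "P = paraorthogonal \<Phi> \<beta> n"
    define \<eta> where "\<eta> t = real n * t - 2 * S (n - 1) t" for t
    have roots: "image_mset (\<lambda>j. exp (\<i> * of_real (\<theta> n j))) (mset_set {1..n}) = proots P"
      unfolding P_def by (rule assms(8)[OF n])
    \<comment> \<open>\<open>proots 0\<close> is empty by convention, while the multiset on the left
      has \<open>n \<ge> 1\<close> elements.\<close>
    from arg_cong[OF roots, of size] have "P \<noteq> 0"
      using n by auto
    moreover from arg_cong[OF roots, of set_mset]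
    have "set_mset (proots P) = (\<lambda>j. cis (\<theta> n j)) ` {1..n}"
      by (simp add: cis_conv_exp)
    ultimately have zeros: "{z. poly P z = 0} = (\<lambda>j. cis (\<theta> n j)) ` {1..n}"
      by simp
    have zero_iff: "poly P (cis t) = 0 \<longleftrightarrow> cis (\<eta> t) = cnj (\<beta> n)" for t
      unfolding P_def \<eta>_def S_def by (rule paraorthogonal_zero_iff[OF M \<Phi> n])
    have "\<eta> (\<theta> n (j + 1)) - \<eta> (\<theta> n j) = 2 * pi"
    proof (rule phase_increment[where \<eta> = \<eta> and t = "\<theta> n" and c = "cnj (\<beta> n)", OF _ n _ _ _ _ _ _ j])
      show "continuous_on UNIV \<eta>"
        unfolding \<eta>_def S_def by (intro continuous_intros continuous_on_szego_phase[OF M \<Phi>])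
      show "\<eta> (x + 2 * pi) = \<eta> x + 2 * pi * real n" for x
        unfolding \<eta>_def S_def szego_phase_periodic by (simp add: algebra_simps)
      show "cis (\<eta> (\<theta> n 1)) = cnj (\<beta> n)"
        using zeros n by (auto simp flip: zero_iff)
      show "\<exists>j\<in>{1..n}. cis x = cis (\<theta> n j)" if "cis (\<eta> x) = cnj (\<beta> n)" for x
        using zeros that by (auto simp flip: zero_iff)
    qed (use assms(6,7,9) n in auto)
    then show ?thesis
      by (simp add: \<eta>_def algebra_simps)
  qed
  obtain l where "uniform_limit UNIV S l sequentially"
    using szego_phase_uniform_limit[OF M \<Phi> summ] by (auto simp: S_def)
  \<comment> \<open>This compact interval contains all angles, including the wrapped one, which is
    below \<open>4 * pi\<close>.\<close>
  then have lim: "uniform_limit {0..4 * pi} S l sequentially"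
    by (rule uniform_limit_on_subset) simp
  have cont: "continuous_on {0..4 * pi} (S n)" for n
    unfolding S_def by (rule continuous_on_szego_phase[OF M \<Phi>])
  show ?thesis
  proof (rule LIMSEQ_I)
    fix \<epsilon> :: real assume \<epsilon>: "\<epsilon> > 0"
    obtain \<delta> N where \<delta>: "\<delta> > 0" and N: "\<And>n x y. n \<ge> N \<Longrightarrow> x \<in> {0..4 * pi} \<Longrightarrow> y \<in> {0..4 * pi}
        \<Longrightarrow> dist x y < \<delta> \<Longrightarrow> dist (S n x) (S n y) < \<epsilon> / 4"
      using uniform_limit_equicontinuous[OF compact_Icc cont lim, of "\<epsilon> / 4"] \<epsilon> by auto
    \<comment> \<open>From \<open>K\<close> on, the a priori gap bound
      \<open>(2 * pi + 4 * B) / n\<close> is below \<delta>.\<close>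
    obtain K :: nat where K: "(2 * pi + 4 * B) / \<delta> < real K"
      using reals_Archimedean2 by blast
    show "\<exists>no. \<forall>n\<ge>no. norm ((SUP j\<in>{1..n}. real n * \<bar>\<theta> n (j + 1) - \<theta> n j - 2 * pi / real n\<bar>) - 0) < \<epsilon>"
    proof (intro exI allI impI)
      \<comment> \<open>\<open>Suc N\<close>, because the phase that occurs has index
        \<open>n - 1\<close>.\<close>
      fix n assume n: "n \<ge> max (Suc N) K"
      then have n1: "n \<ge> 1"
        by simp
      \<comment> \<open>Twice a phase increment below \<open>\<epsilon> / 4\<close>; the remaining
        half of \<epsilon> keeps the supremum strictly below \<epsilon>.\<close>
      have bound: "real n * \<bar>\<theta> n (j + 1) - \<theta> n j - 2 * pi / real n\<bar> \<le> \<epsilon> / 2"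
        if j: "j \<in> {1..n}" for j
      proof -
        have "0 \<le> \<theta> n 1" "\<theta> n 1 < 2 * pi" "0 \<le> \<theta> n j" "\<theta> n j < 2 * pi"
          using assms(6)[of 1 n] assms(6)[of j n] n1 j by auto
        moreover have "\<theta> n (j + 1) = \<theta> n 1 + 2 * pi \<or> (0 \<le> \<theta> n (j + 1) \<and> \<theta> n (j + 1) < 2 * pi)"
          using assms(9)[OF n1] assms(6)[of "j + 1" n] j by (cases "j = n") auto
        moreover have "\<theta> n j \<le> \<theta> n (j + 1)"
          using calculation mono[of j "j + 1" n] assms(9)[OF n1] j by (cases "j = n") auto
        ultimately have range: "\<theta> n j \<in> {0..4 * pi}" "\<theta> n (j + 1) \<in> {0..4 * pi}"
          and le: "\<theta> n j \<le> \<theta> n (j + 1)"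
          by auto
        have "real n * (\<theta> n (j + 1) - \<theta> n j) - 2 * pi \<le> 4 * B"
          unfolding incr[OF j] by (rule S_diff)
        then have "real n * (\<theta> n (j + 1) - \<theta> n j) \<le> 2 * pi + 4 * B"
          by (simp only: diff_le_eq add.commute)
        also have "\<dots> < real K * \<delta>"
          using K \<delta> by (simp add: pos_divide_less_eq)
        also have "\<dots> \<le> real n * \<delta>"
          using n \<delta> by (intro mult_right_mono) auto
        finally have "\<theta> n (j + 1) - \<theta> n j < \<delta>"
          using n1 by simp
        then have "dist (S (n - 1) (\<theta> n (j + 1))) (S (n - 1) (\<theta> n j)) < \<epsilon> / 4"
          using n le range by (intro N) (auto simp: dist_real_def)
        then have "\<bar>real n * (\<theta> n (j + 1) - \<theta> n j) - 2 * pi\<bar> \<le> \<epsilon> / 2"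
          unfolding incr[OF j] dist_real_def abs_mult by simp
        moreover have "real n * \<bar>\<theta> n (j + 1) - \<theta> n j - 2 * pi / real n\<bar>
            = \<bar>real n * (\<theta> n (j + 1) - \<theta> n j - 2 * pi / real n)\<bar>"
          by (simp add: abs_mult)
        moreover have "real n * (\<theta> n (j + 1) - \<theta> n j - 2 * pi / real n)
            = real n * (\<theta> n (j + 1) - \<theta> n j) - 2 * pi"
          using n1 by (simp add: right_diff_distrib)
        ultimately show ?thesis
          by simp
      qed
      have "(SUP j\<in>{1..n}. real n * \<bar>\<theta> n (j + 1) - \<theta> n j - 2 * pi / real n\<bar>) \<le> \<epsilon> / 2"
        using n1 bound by (intro cSUP_least) auto
      moreover have "0 \<le> (SUP j\<in>{1..n}. real n * \<bar>\<theta> n (j + 1) - \<theta> n j - 2 * pi / real n\<bar>)"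
        using n1 by (intro cSUP_upper2[of _ _ 1]) auto
      ultimately show "norm ((SUP j\<in>{1..n}. real n * \<bar>\<theta> n (j + 1) - \<theta> n j - 2 * pi / real n\<bar>) - 0) < \<epsilon>"
        using \<epsilon> by simp
    qed
  qed
qed

end
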